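(* Let $n\ge 1$, let $J$ be a real symmetric $n\times n$ matrix with $0\preceq J\prec \mathrm{Id}$, let $h\in\mathbb{R}^n$, and let $\nu_0$ be the probability measure on $\{\pm1\}^n$ given by $$d\nu_0(x)=\frac1Z\exp\left(\tfrac12\langle x,Jx\rangle+\langle h,x\rangle\right)d\mu(x),$$ where $\mu$ is the uniform probability measure on $\{\pm1\}^n$ and $Z$ is the normalizing constant. Then for every function $\varphi:\{\pm1\}^n\to\mathbb{R}$, $$(1-\|J\|_{OP})\,\mathrm{Var}_{\nu_0}(\varphi(X))\le \mathcal{E}_{\nu_0}(\varphi,\varphi).$$
   Context: $\preceq$ and $\prec$ denote the Loewner order on symmetric matrices, and $\|J\|_{OP}$ is the $\ell_2\to\ell_2$ operator norm. For a probability measure $\nu$ on $\{\pm1\}^n$ and $X\sim\nu$, the Dirichlet form of the (continuous-time) Glauber dynamics is $$\mathcal{E}_{\nu}(\varphi,\varphi)=\mathbb{E}_{\nu}\sum_{i=1}^n\big(\mathbb{E}_{\nu}[\varphi(X)\mid X_{\sim i}]-\varphi(X)\big)^2,$$ where $X_{\sim i}=(X_j)_{j\ne i}$. *)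

theory Defs
  imports "HOL-Probability.Probability"
begin

text \<open>Matrices and vectors are indexed by a finite type \<open>'n\<close>, whose cardinality is the dimension.\<close>

definition loewner_le :: "real^'n^'n \<Rightarrow> real^'n^'n \<Rightarrow> bool" where
  "loewner_le A B \<longleftrightarrow> (\<forall>x. 0 \<le> x \<bullet> ((B - A) *v x))"

text \<open>Both relations are meant for symmetric matrices; symmetry is not part of the definitions
  and has to be assumed separately. The strict order says that \<open>B - A\<close> is positive definite; this is stronger than
  \<^term>\<open>loewner_le A B \<and> A \<noteq> B\<close>.\<close>

definition loewner_less :: "real^'n^'n \<Rightarrow> real^'n^'n \<Rightarrow> bool" where
  "loewner_less A B \<longleftrightarrow> (\<forall>x. x \<noteq> 0 \<longrightarrow> 0 < x \<bullet> ((B - A) *v x))"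

definition op_norm :: "real^'n^'n \<Rightarrow> real" where
  "op_norm J = onorm (\<lambda>x. J *v x)"

definition hypercube :: "(real^'n) set" where
  "hypercube = {x. \<forall>i. x $ i \<in> {-1, 1}}"

definition cube_uniform :: "(real^'n) measure" where
  "cube_uniform = uniform_count_measure hypercube"

definition ising_weight :: "real^'n^'n \<Rightarrow> real^'n \<Rightarrow> real^'n \<Rightarrow> real" where
  "ising_weight J h x = exp (1/2 * (x \<bullet> (J *v x)) + h \<bullet> x)"

definition ising_Z :: "real^'n^'n \<Rightarrow> real^'n \<Rightarrow> real" where
  "ising_Z J h = (\<integral>x. ising_weight J h x \<partial>cube_uniform)"

definition ising_measure :: "real^'n^'n \<Rightarrow> real^'n \<Rightarrow> (real^'n) measure" where
  "ising_measure J h = density cube_uniform (\<lambda>x. ennreal (1 / ising_Z J h * ising_weight J h x))"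

text \<open>The sigma-algebra on \<^const>\<open>hypercube\<close> generated by the random vector \<open>(X\<^sub>j)\<close>,
  \<open>j \<noteq> i\<close>, where \<open>X\<close> is the identity map (the measure carried by
  \<^const>\<open>vimage_algebra\<close> is irrelevant).\<close>

definition sigma_except :: "'n \<Rightarrow> (real^'n) measure" where
  "sigma_except i =
     vimage_algebra hypercube (\<lambda>x. \<lambda>j\<in>-{i}. x $ j) (PiM (-{i}) (\<lambda>_. count_space {-1, 1}))"

text \<open>Here \<open>\<nu>\<close> is meant to be a probability measure with underlying space
  \<^const>\<open>hypercube\<close> and all subsets measurable, and \<open>\<phi>\<close> only matters on \<^const>\<open>hypercube\<close>.
  The conditional expectation \<^const>\<open>real_cond_exp\<close> is determined up to \<open>\<nu>\<close>-null sets.\<close>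

definition dirichlet_form :: "(real^'n) measure \<Rightarrow> (real^'n \<Rightarrow> real) \<Rightarrow> real" where
  "dirichlet_form \<nu> \<phi> =
     prob_space.expectation \<nu> (\<lambda>x. \<Sum>i\<in>UNIV. (real_cond_exp \<nu> (sigma_except i) \<phi> x - \<phi> x)\<^sup>2)"

end

theory Submission
  imports Defs "HOL-Real_Asymp.Real_Asymp"
begin

text \<open>Write \<open>\<langle>x, J x\<rangle> = \<Sum>\<^sub>k \<langle>u\<^sub>k, x\<rangle>\<^sup>2\<close>. By the Hubbard--Stratonovich identity
  \<open>exp (a\<^sup>2 / 2) = E exp (g a)\<close>, \<open>g\<close> standard Gaussian, the Ising measure is obtained from product measures by
  successive mixtures over one real Gaussian field per \<open>u\<^sub>k\<close>. Let \<open>\<nu>\<close> be a mixture of \<open>\<nu>\<^sub>g\<close>, tilted by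
  \<open>g \<langle>u, x\<rangle>\<close>, and let \<open>F(g)\<close> be the \<open>\<nu>\<^sub>g\<close>-mean of \<open>\<phi>\<close>. Then \<open>Var\<^sub>\<nu> \<phi> = E Var\<^sub>g \<phi> + Var F\<close>, and the
  one-dimensional Brascamp--Lieb inequality gives \<open>Var F \<le> E (2 f F' - f\<^sup>2 V'')\<close> for a certain function \<open>f\<close>, where
  \<open>F'\<close> is the covariance of \<open>\<phi>\<close> and \<open>\<langle>u, x\<rangle>\<close> and \<open>V'' = 1 - Var\<^sub>g \<langle>u, x\<rangle>\<close>. The right-hand sides combine to
  \<open>E (Var\<^sub>g (\<phi> + f \<langle>u, x\<rangle>) - f\<^sup>2)\<close>. Hence bounds of the form \<open>Var (\<phi> + \<Sum> t\<^sub>k \<langle>u\<^sub>k, x\<rangle>) \<le> E G + \<Sum> t\<^sub>k\<^sup>2\<close>, for all \<open>t\<close>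
  and with a fixed function \<open>G\<close> on the cube, pass from product measures to the Ising measure.
  For product measures the bound follows from the Efron--Stein inequality with
  \<open>G = (1 - \<parallel>J\<parallel>)\<^sup>-\<^sup>1 \<Sum>\<^sub>i (\<phi> - e\<^sub>i)\<^sup>2\<close>, for any \<open>e\<^sub>i\<close> not depending on the \<open>i\<close>-th coordinate; the conditional
  expectations under the Ising measure are admissible.\<close>

section \<open>Weighted means on finite sets\<close>

text \<open>The weights are left unnormalised, so that multiplying them by an exponential tilt stays
  within the same notation.\<close>

definition wmean :: "'a set \<Rightarrow> ('a \<Rightarrow> real) \<Rightarrow> ('a \<Rightarrow> real) \<Rightarrow> real" where
  "wmean X w f = (\<Sum>x\<in>X. w x * f x) / (\<Sum>x\<in>X. w x)"

definition wvar :: "'a set \<Rightarrow> ('a \<Rightarrow> real) \<Rightarrow> ('a \<Rightarrow> real) \<Rightarrow> real" where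
  "wvar X w f = wmean X w (\<lambda>x. (f x - wmean X w f)\<^sup>2)"

lemma wmean_add: "wmean X w (\<lambda>x. f x + g x) = wmean X w f + wmean X w g"
  by (simp add: wmean_def distrib_left sum.distrib add_divide_distrib)

lemma wmean_diff: "wmean X w (\<lambda>x. f x - g x) = wmean X w f - wmean X w g"
  by (simp add: wmean_def right_diff_distrib sum_subtractf diff_divide_distrib)

lemma wmean_mult: "wmean X w (\<lambda>x. c * f x) = c * wmean X w f"
  by (simp add: wmean_def sum_distrib_left mult.left_commute)

lemma wmean_cong:
  "(\<And>x. x \<in> X \<Longrightarrow> f x = g x) \<Longrightarrow> wmean X w f = wmean X w g"
  by (simp add: wmean_def)

lemma wmean_mono:
  assumes "\<forall>x\<in>X. 0 < w x" "\<And>x. x \<in> X \<Longrightarrow> f x \<le> g x"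
  shows "wmean X w f \<le> wmean X w g"
  unfolding wmean_def
  by (intro divide_right_mono sum_mono mult_left_mono sum_nonneg) (use assms in \<open>auto intro: less_imp_le\<close>)

lemma wmean_const:
  assumes "finite X" "X \<noteq> {}" "\<forall>x\<in>X. 0 < w x"
  shows "wmean X w (\<lambda>x. c) = c"
proof -
  have "0 < sum w X" using assms by (intro sum_pos) auto
  then show ?thesis by (simp add: wmean_def sum_distrib_right [symmetric])
qed

lemma wmean_sqr_diff:
  assumes "finite X" "X \<noteq> {}" "\<forall>x\<in>X. 0 < w x"
  shows "wmean X w (\<lambda>x. (f x - c)\<^sup>2) = wmean X w (\<lambda>x. (f x)\<^sup>2) - 2 * c * wmean X w f + c\<^sup>2"
proof -
  have "wmean X w (\<lambda>x. (f x - c)\<^sup>2) = wmean X w (\<lambda>x. ((f x)\<^sup>2 - (2 * c) * f x) + c\<^sup>2)"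
    by (intro wmean_cong) (simp add: power2_diff)
  then show ?thesis
    unfolding wmean_add wmean_diff wmean_mult wmean_const [OF assms] .
qed

lemma wvar_eq:
  assumes "finite X" "X \<noteq> {}" "\<forall>x\<in>X. 0 < w x"
  shows "wvar X w f = wmean X w (\<lambda>x. (f x)\<^sup>2) - (wmean X w f)\<^sup>2"
  unfolding wvar_def wmean_sqr_diff [OF assms] by (simp add: power2_eq_square)

lemma wvar_le:
  assumes "finite X" "X \<noteq> {}" "\<forall>x\<in>X. 0 < w x"
  shows "wvar X w f \<le> wmean X w (\<lambda>x. (f x - c)\<^sup>2)"
  using zero_le_power2 [of "wmean X w f - c"]
  unfolding wvar_eq [OF assms] wmean_sqr_diff [OF assms]
  by (simp add: power2_diff algebra_simps)

lemma wvar_shift: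
  assumes "finite X" "X \<noteq> {}" "\<forall>x\<in>X. 0 < w x"
  shows "wvar X w (\<lambda>x. f x - c) = wvar X w f"
  unfolding wvar_def wmean_diff wmean_const [OF assms] by simp

section \<open>Gaussian mixtures of exponential tilts\<close>

text \<open>Gaussian integrals are handled below as limits of an antiderivative at both ends. Of the
  total mass \<open>L\<close> only the positivity is used, so its value is not computed.\<close>

lemma gaussian_antiderivative:
  obtains \<Phi> :: "real \<Rightarrow> real" and L where
    "\<And>s. (\<Phi> has_real_derivative exp (- s\<^sup>2 / 2)) (at s)"
    "(\<Phi> \<longlongrightarrow> 0) at_bot" "(\<Phi> \<longlongrightarrow> L) at_top" "0 < L"
proof -
  define \<Psi> where "\<Psi> = (\<lambda>x::real. LBINT s=0..x. exp (- s\<^sup>2 / 2))"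
  have der: "(\<Psi> has_real_derivative exp (- x\<^sup>2 / 2)) (at x)" for x
  proof -
    \<comment> \<open>The interval has \<open>x\<close> in its interior, so the derivative within it
      is the full derivative.\<close>
    define r where "r = \<bar>x\<bar> + 1"
    have "((\<lambda>u. LBINT s=0..u. exp (- s\<^sup>2 / 2)) has_vector_derivative exp (- x\<^sup>2 / 2))
            (at x within {-r..r})"
      unfolding zero_ereal_def by (rule interval_integral_FTC2) (auto simp: r_def intro!: continuous_intros)
    moreover have "at x within {-r..r} = at x"
      by (rule at_within_interior) (auto simp: r_def interior_atLeastAtMost_real)
    ultimately show ?thesis
      by (simp add: \<Psi>_def has_real_derivative_iff_has_vector_derivative)
  qed
  have \<Psi>0: "\<Psi> 0 = 0"
    by (simp add: \<Psi>_def zero_ereal_def)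
  have odd: "\<Psi> (- x) = - \<Psi> x" for x
  proof -
    have "((\<lambda>x. \<Psi> x + \<Psi> (- x)) has_real_derivative 0) (at x)" for x
      by (auto intro!: derivative_eq_intros DERIV_chain2 [OF der])
    from DERIV_isconst_all [of "\<lambda>x. \<Psi> x + \<Psi> (- x)" x 0] this \<Psi>0 show ?thesis
      by simp
  qed
  have sm: "\<Psi> x < \<Psi> y" if "x < y" for x y
    using that by (rule DERIV_pos_imp_increasing) (use der in force)
  \<comment> \<open>Comparison with 2 arctan:
    \<open>1 + s\<^sup>2 \<le> 2 * exp (s\<^sup>2 / 2)\<close> bounds the density by the derivative
    of 2 arctan, whose values stay below pi.\<close>
  have bound: "\<Psi> x \<le> pi" for x
  proof (cases "x \<ge> 0")
    case True
    have "2 * arctan 0 - \<Psi> 0 \<le> 2 * arctan x - \<Psi> x"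
    proof (rule DERIV_nonneg_imp_nondecreasing [OF True], intro exI conjI)
      fix s :: real
      show "((\<lambda>s. 2 * arctan s - \<Psi> s) has_real_derivative 2 * inverse (1 + s\<^sup>2) - exp (- s\<^sup>2 / 2)) (at s)"
        by (auto intro!: derivative_eq_intros der)
      have "1 + s\<^sup>2 \<le> 2 * exp (s\<^sup>2 / 2)"
        using exp_ge_add_one_self [of "s\<^sup>2 / 2"] zero_le_power2 [of s] by linarith
      moreover have "0 < 1 + s\<^sup>2" by (simp add: add_pos_nonneg)
      ultimately show "0 \<le> 2 * inverse (1 + s\<^sup>2) - exp (- s\<^sup>2 / 2)"
        by (simp add: exp_minus field_simps)
    qed
    then show ?thesis using \<Psi>0 arctan_ubound [of x] by simp
  next
    case False
    then show ?thesis using sm [of x 0] \<Psi>0 pi_gt_zero by linarith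
  qed
  have mono: "mono \<Psi>"
    by (intro monoI) (metis sm less_eq_real_def)
  have "convergent (\<lambda>n. \<Psi> (real n))"
  proof (rule Bseq_mono_convergent)
    have "0 \<le> \<Psi> (real n)" for n
      using monoD [OF mono, of 0 "real n"] \<Psi>0 by simp
    then show "Bseq (\<lambda>n. \<Psi> (real n))"
      using bound by (intro BseqI' [where K = pi]) simp
  qed (use mono in \<open>simp add: mono_def\<close>)
  then obtain l where l: "(\<lambda>n. \<Psi> (real n)) \<longlonglongrightarrow> l"
    by (auto simp: convergent_def)
  have top: "(\<Psi> \<longlongrightarrow> l) at_top"
    using mono l by (intro tendsto_at_topI_sequentially_real) auto
  have bot: "(\<Psi> \<longlongrightarrow> - l) at_bot"
    unfolding filterlim_at_bot_mirror odd by (intro tendsto_intros top)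
  have "\<Psi> 1 \<le> l"
    by (rule tendsto_lowerbound [OF top])
      (auto simp: eventually_at_top_linorder intro!: exI [of _ 1] monoD [OF mono])
  then have "0 < l"
    using sm [of 0 1] \<Psi>0 by simp
  show ?thesis
  proof (rule that [of "\<lambda>x. \<Psi> x + l" "2 * l"])
    show "((\<lambda>x. \<Psi> x + l) has_real_derivative exp (- s\<^sup>2 / 2)) (at s)" for s
      by (auto intro!: derivative_eq_intros der)
    show "((\<lambda>x. \<Psi> x + l) \<longlongrightarrow> 0) at_bot"
      using tendsto_add [OF bot tendsto_const [of l]] by simp
    show "((\<lambda>x. \<Psi> x + l) \<longlongrightarrow> 2 * l) at_top"
      using tendsto_add [OF top tendsto_const [of l]] by simp
  qed (use \<open>0 < l\<close> in simp)
qed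

text \<open>This lemma and its mirror image at +infinity take the place of integrating an inequality
  over a half-line.\<close>

lemma DERIV_nonneg_at_bot_lower:
  fixes f :: "real \<Rightarrow> real"
  assumes der: "\<And>x. x \<le> b \<Longrightarrow> \<exists>y. DERIV f x :> y \<and> 0 \<le> y"
    and lim: "(f \<longlongrightarrow> l) at_bot"
  shows "l \<le> f b"
proof (rule tendsto_upperbound [OF lim])
  have "f x \<le> f b" if "x \<le> b" for x
    using that by (rule DERIV_nonneg_imp_nondecreasing) (use der in auto)
  then show "\<forall>\<^sub>F x in at_bot. f x \<le> f b"
    using eventually_at_bot_linorder by blast
qed simp

lemma DERIV_nonpos_at_top_lower:
  fixes f :: "real \<Rightarrow> real"
  assumes der: "\<And>x. b \<le> x \<Longrightarrow> \<exists>y. DERIV f x :> y \<and> y \<le> 0"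
    and lim: "(f \<longlongrightarrow> l) at_top"
  shows "l \<le> f b"
proof (rule tendsto_upperbound [OF lim])
  have "f x \<le> f b" if "b \<le> x" for x
    using that by (rule DERIV_nonpos_imp_nonincreasing) (use der in auto)
  then show "\<forall>\<^sub>F x in at_top. f x \<le> f b"
    using eventually_at_top_linorder by blast
qed simp

text \<open>This kills the boundary terms of the next lemma, where a linear factor arises from V'.
  Reflection replaces \<open>a\<close> by \<open>- a\<close>, which reduces -infinity to
  +infinity.\<close>

lemma linear_gaussian_tendsto_0:
  fixes K a :: real
  assumes "F \<in> {at_top, at_bot}"
  shows "((\<lambda>g. (\<bar>g\<bar> + K) * (exp (- g\<^sup>2 / 2) * exp (g * a))) \<longlongrightarrow> 0) F"
proof -
  have "((\<lambda>g. (\<bar>g\<bar> + K) * (exp (- g\<^sup>2 / 2) * exp (g * a))) \<longlongrightarrow> 0) at_top" for a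
    unfolding exp_add [symmetric] by real_asymp
  from this [of a] this [of "- a"] show ?thesis
    using assms by (auto simp: filterlim_at_bot_mirror)
qed

text \<open>Put \<open>e\<^sup>-\<^sup>V = A\<close> with \<open>V' = v\<close>, and let \<open>F\<close> be the mean of \<open>\<phi>\<close> under the tilted measure.
  The function \<open>f = - P / A\<close> solves \<open>V' f - f' = F\<close>, as in the dual proof of the Brascamp--Lieb inequality,
  and \<open>f(g)\<close> is the parameter \<open>t\<close> at which the hypothesis is used. Then
  \<open>A (F\<^sup>2 - 2 f F' + f\<^sup>2 V'') = T' - A f'\<^sup>2\<close> where \<open>T = A (V' f\<^sup>2 - 2 F f)\<close> vanishes at both ends.\<close>

lemma gaussian_tilt_centered:
  fixes c a \<phi> G :: "'a \<Rightarrow> real"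
  defines "w \<equiv> \<lambda>x. c x * exp ((a x)\<^sup>2 / 2)"
  assumes fin: "finite X" "X \<noteq> {}" and pos: "\<forall>x\<in>X. 0 < c x"
    and hyp: "\<And>g t. wvar X (\<lambda>x. c x * exp (g * a x)) (\<lambda>x. \<phi> x + t * a x)
                       \<le> wmean X (\<lambda>x. c x * exp (g * a x)) G + t\<^sup>2"
    and centered: "(\<Sum>x\<in>X. w x * \<phi> x) = 0"
  shows "(\<Sum>x\<in>X. w x * (\<phi> x)\<^sup>2) \<le> (\<Sum>x\<in>X. w x * G x)"
proof -
  obtain \<Phi> :: "real \<Rightarrow> real" and L where
    \<Phi>: "\<And>s. (\<Phi> has_real_derivative exp (- s\<^sup>2 / 2)) (at s)" and
    \<Phi>_bot: "(\<Phi> \<longlongrightarrow> 0) at_bot" and \<Phi>_top: "(\<Phi> \<longlongrightarrow> L) at_top" and L: "0 < L"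
    using gaussian_antiderivative by metis
  define S where "S k g = (\<Sum>x\<in>X. c x * exp (g * a x) * k x)" for k g
  define Z where "Z = S (\<lambda>x. 1)"
  define E where "E g = exp (- g\<^sup>2 / 2)" for g :: real
  define A where "A g = E g * Z g" for g
  define F where "F g = S \<phi> g / Z g" for g
  define F1 where "F1 g = (S (\<lambda>x. \<phi> x * a x) g * Z g - S \<phi> g * S a g) / (Z g * Z g)" for g
  define v where "v g = g - S a g / Z g" for g
  define v1 where "v1 g = 1 - (S (\<lambda>x. a x * a x) g * Z g - S a g * S a g) / (Z g * Z g)" for g
  \<comment> \<open>Completing the square makes \<open>H k\<close> the antiderivative of
    \<open>E g * S k g\<close> that vanishes at -infinity. Its limit at +infinity is
    \<open>L\<close> times the \<open>w\<close>-sum of \<open>k\<close>: this is the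
    Hubbard--Stratonovich identity.\<close>
  define H where "H k g = (\<Sum>x\<in>X. w x * k x * \<Phi> (g - a x))" for k g
  define P where "P = H \<phi>"
  define Q where "Q = H (\<lambda>x. (\<phi> x)\<^sup>2 - G x)"
  define T where "T g = v g * (P g)\<^sup>2 / A g + 2 * F g * P g" for g
  have Zpos: "0 < Z g" for g
    unfolding Z_def S_def using fin pos by (intro sum_pos) auto
  have Epos: "0 < E g" for g by (simp add: E_def)
  have Apos: "0 < A g" for g using Zpos Epos by (simp add: A_def)
  have S_der: "(S k has_real_derivative S (\<lambda>x. k x * a x) g) (at g)" for k g
    unfolding S_def by (auto intro!: derivative_eq_intros sum.cong)
  have Z_der: "(Z has_real_derivative S a g) (at g)" for g
    using S_der [of "\<lambda>x. 1" g] by (simp add: Z_def)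
  have E_der: "(E has_real_derivative - g * E g) (at g)" for g
    unfolding E_def by (auto intro!: derivative_eq_intros)
  have A_der: "(A has_real_derivative - v g * A g) (at g)" for g
    unfolding A_def using Zpos [of g]
    by (auto intro!: derivative_eq_intros E_der Z_der simp: v_def field_simps)
  have F_der: "(F has_real_derivative F1 g) (at g)" for g
    unfolding F_def F1_def using Zpos [of g]
    by (auto intro!: derivative_eq_intros S_der Z_der)
  have v_der: "(v has_real_derivative v1 g) (at g)" for g
    unfolding v_def v1_def using Zpos [of g]
    by (auto intro!: derivative_eq_intros S_der Z_der)
  have H_der: "(H k has_real_derivative E g * S k g) (at g)" for k g
  proof -
    have "w x * exp (- (g - a x)\<^sup>2 / 2) = E g * (c x * exp (g * a x))" for x
      by (simp add: w_def E_def exp_add [symmetric] power2_diff field_simps)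
    then have eq: "w x * k x * exp (- (g - a x)\<^sup>2 / 2) = E g * (c x * exp (g * a x) * k x)" for x
      by (metis mult.assoc mult.commute)
    have "((\<lambda>g. w x * k x * \<Phi> (g - a x)) has_real_derivative E g * (c x * exp (g * a x) * k x)) (at g)" for x
    proof -
      have "((\<lambda>g. g - a x) has_real_derivative 1) (at g)"
        by (auto intro!: derivative_eq_intros)
      from DERIV_cmult [OF DERIV_chain2 [OF \<Phi> this], of "w x * k x"] show ?thesis
        by (simp only: eq mult_1_right)
    qed
    then show ?thesis
      unfolding H_def S_def sum_distrib_left by (intro DERIV_sum)
  qed
  have P_der: "(P has_real_derivative A g * F g) (at g)" for g
    using H_der [of \<phi> g] Zpos [of g] by (simp add: P_def A_def F_def)
  have Q_der: "(Q has_real_derivative E g * (S (\<lambda>x. (\<phi> x)\<^sup>2) g - S G g)) (at g)" for g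
    using H_der [of "\<lambda>x. (\<phi> x)\<^sup>2 - G x" g]
    by (simp add: Q_def S_def right_diff_distrib sum_subtractf)
  have T_der: "(T has_real_derivative v1 g * (P g)\<^sup>2 / A g + v g * (2 * P g * F g) + (v g)\<^sup>2 * (P g)\<^sup>2 / A g
                 + 2 * F1 g * P g + 2 * A g * (F g)\<^sup>2) (at g)" for g
    unfolding T_def using Apos [of g]
    by (auto intro!: derivative_eq_intros A_der P_der F_der v_der)
       (simp add: field_simps power2_eq_square)
  \<comment> \<open>The tilted variance of \<open>\<phi> + t * a\<close> is a quadratic in
    \<open>t\<close> with cross term \<open>2 * t * F1 g\<close> and leading coefficient
    \<open>1 - v1 g\<close>. The 1 cancels against the \<open>t\<^sup>2\<close> of the
    hypothesis.\<close>
  have key: "(S (\<lambda>x. (\<phi> x)\<^sup>2) g - S G g) / Z g \<le> (F g)\<^sup>2 - 2 * t * F1 g + t\<^sup>2 * v1 g" for g t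
  proof -
    have wm: "wmean X (\<lambda>x. c x * exp (g * a x)) k = S k g / Z g" for k
      by (simp add: wmean_def S_def Z_def)
    have "S (\<lambda>x. (\<phi> x + t * a x)\<^sup>2) g = S (\<lambda>x. (\<phi> x)\<^sup>2) g + 2 * t * S (\<lambda>x. \<phi> x * a x) g + t\<^sup>2 * S (\<lambda>x. a x * a x) g"
      by (simp add: S_def sum_distrib_left sum.distrib [symmetric] power2_sum power_mult_distrib
          power2_eq_square algebra_simps)
    moreover have "S (\<lambda>x. \<phi> x + t * a x) g = S \<phi> g + t * S a g"
      by (simp add: S_def sum_distrib_left sum.distrib [symmetric] algebra_simps)
    moreover have "\<forall>x\<in>X. 0 < c x * exp (g * a x)" using pos by simp
    ultimately have "(S (\<lambda>x. (\<phi> x)\<^sup>2) g + 2 * t * S (\<lambda>x. \<phi> x * a x) g + t\<^sup>2 * S (\<lambda>x. a x * a x) g) / Z g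
          - ((S \<phi> g + t * S a g) / Z g)\<^sup>2 \<le> S G g / Z g + t\<^sup>2"
      using hyp [of g t] by (simp add: wvar_eq fin wm)
    moreover have "(F g)\<^sup>2 - 2 * t * F1 g + t\<^sup>2 * v1 g - (S (\<lambda>x. (\<phi> x)\<^sup>2) g - S G g) / Z g
        = S G g / Z g + t\<^sup>2
          - ((S (\<lambda>x. (\<phi> x)\<^sup>2) g + 2 * t * S (\<lambda>x. \<phi> x * a x) g + t\<^sup>2 * S (\<lambda>x. a x * a x) g) / Z g
             - ((S \<phi> g + t * S a g) / Z g)\<^sup>2)"
      using Zpos [of g] unfolding F_def F1_def v1_def
      by (simp add: field_simps power2_eq_square)
    ultimately show ?thesis by linarith
  qed
  have T_Q: "\<exists>y. ((\<lambda>g. T g - Q g) has_real_derivative y) (at g) \<and> 0 \<le> y" for g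
  proof (intro exI conjI)
    show "((\<lambda>g. T g - Q g) has_real_derivative
            (v1 g * (P g)\<^sup>2 / A g + v g * (2 * P g * F g) + (v g)\<^sup>2 * (P g)\<^sup>2 / A g
             + 2 * F1 g * P g + 2 * A g * (F g)\<^sup>2) - E g * (S (\<lambda>x. (\<phi> x)\<^sup>2) g - S G g)) (at g)"
      by (rule DERIV_diff [OF T_der Q_der])
    have "A g * ((S (\<lambda>x. (\<phi> x)\<^sup>2) g - S G g) / Z g)
            \<le> A g * ((F g)\<^sup>2 - 2 * (- P g / A g) * F1 g + (- P g / A g)\<^sup>2 * v1 g)"
      using Apos [of g] by (intro mult_left_mono key) auto
    moreover have "A g * ((S (\<lambda>x. (\<phi> x)\<^sup>2) g - S G g) / Z g) = E g * (S (\<lambda>x. (\<phi> x)\<^sup>2) g - S G g)"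
      using Zpos [of g] by (simp add: A_def)
    \<comment> \<open>The added square is A f'^2 for f = - P / A, because f' = v f - F = - (F + v P
      / A).\<close>
    moreover have "A g * ((F g)\<^sup>2 - 2 * (- P g / A g) * F1 g + (- P g / A g)\<^sup>2 * v1 g) + A g * (F g + v g * P g / A g)\<^sup>2
      = v1 g * (P g)\<^sup>2 / A g + v g * (2 * P g * F g) + (v g)\<^sup>2 * (P g)\<^sup>2 / A g
                 + 2 * F1 g * P g + 2 * A g * (F g)\<^sup>2"
      using Apos [of g] by (simp add: field_simps power2_eq_square)
    moreover have "0 \<le> A g * (F g + v g * P g / A g)\<^sup>2"
      using Apos [of g] by simp
    ultimately show "0 \<le> v1 g * (P g)\<^sup>2 / A g + v g * (2 * P g * F g) + (v g)\<^sup>2 * (P g)\<^sup>2 / A g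
                 + 2 * F1 g * P g + 2 * A g * (F g)\<^sup>2 - E g * (S (\<lambda>x. (\<phi> x)\<^sup>2) g - S G g)"
      by linarith
  qed
  \<comment> \<open>Uniformity in \<open>g\<close> makes \<open>F\<close> bounded and
    \<open>v\<close> of linear growth, which controls \<open>T\<close> at both ends.\<close>
  have S_bound: "\<exists>K\<ge>0. \<forall>g. \<bar>S k g / Z g\<bar> \<le> K" for k
  proof (intro exI conjI allI)
    show "0 \<le> (\<Sum>x\<in>X. \<bar>k x\<bar>)" by (intro sum_nonneg) auto
    fix g
    have "\<bar>S k g\<bar> \<le> (\<Sum>x\<in>X. c x * exp (g * a x) * \<bar>k x\<bar>)"
      unfolding S_def using pos
      by (intro order_trans [OF sum_abs] sum_mono) (simp add: abs_mult abs_of_pos)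
    also have "\<dots> \<le> (\<Sum>x\<in>X. c x * exp (g * a x) * (\<Sum>x\<in>X. \<bar>k x\<bar>))"
      using fin pos by (intro sum_mono mult_left_mono member_le_sum) (auto intro: less_imp_le)
    also have "\<dots> = (\<Sum>x\<in>X. \<bar>k x\<bar>) * Z g"
      by (simp add: Z_def S_def sum_distrib_left sum_distrib_right mult_ac)
    finally show "\<bar>S k g / Z g\<bar> \<le> (\<Sum>x\<in>X. \<bar>k x\<bar>)"
      using Zpos [of g] by (simp add: divide_simps)
  qed
  obtain C where C: "0 \<le> C" "\<And>g. \<bar>F g\<bar> \<le> C"
    using S_bound [of \<phi>] unfolding F_def by blast
  obtain K where K: "0 \<le> K" "\<And>g. \<bar>S a g / Z g\<bar> \<le> K"
    using S_bound [of a] by blast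
  have gA: "((\<lambda>g. (\<bar>g\<bar> + M) * A g) \<longlongrightarrow> 0) \<F>" if "\<F> \<in> {at_top, at_bot}" for M \<F>
  proof -
    have "((\<lambda>g. \<Sum>x\<in>X. c x * ((\<bar>g\<bar> + M) * (exp (- g\<^sup>2 / 2) * exp (g * a x)))) \<longlongrightarrow> (\<Sum>x\<in>X. c x * 0)) \<F>"
      by (intro tendsto_sum tendsto_mult tendsto_const linear_gaussian_tendsto_0 that)
    then show ?thesis
      by (simp add: A_def Z_def S_def E_def sum_distrib_left sum_distrib_right mult_ac)
  qed
  have A0: "(A \<longlongrightarrow> 0) \<F>" if \<F>: "\<F> \<in> {at_top, at_bot}" for \<F>
    using tendsto_diff [OF gA [OF \<F>, of 1] gA [OF \<F>, of 0]] by (simp add: algebra_simps)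
  have sub_top: "filterlim (\<lambda>g. g - b) at_top at_top" and sub_bot: "filterlim (\<lambda>g. g - b) at_bot at_bot" for b :: real
    by real_asymp+
  have H_bot: "(H k \<longlongrightarrow> 0) at_bot" for k
  proof -
    have "(H k \<longlongrightarrow> (\<Sum>x\<in>X. w x * k x * 0)) at_bot"
      unfolding H_def
      by (intro tendsto_sum tendsto_mult tendsto_const filterlim_compose [OF \<Phi>_bot] sub_bot)
    then show ?thesis by simp
  qed
  have H_top: "(H k \<longlongrightarrow> (\<Sum>x\<in>X. w x * k x) * L) at_top" for k
    unfolding H_def sum_distrib_right
    by (intro tendsto_sum tendsto_mult tendsto_const filterlim_compose [OF \<Phi>_top] sub_top)
  \<comment> \<open>At +infinity the limit of \<open>P\<close> is \<open>L\<close> times the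
    \<open>w\<close>-sum of \<open>\<phi>\<close>, which is zero by centering.\<close>
  have P_bot: "(P \<longlongrightarrow> 0) at_bot" and P_top: "(P \<longlongrightarrow> 0) at_top"
    using H_bot [of \<phi>] H_top [of \<phi>] by (simp_all add: P_def centered)
  have AF: "\<bar>A g * F g\<bar> \<le> C * A g" for g
    using mult_left_mono [OF C(2) [of g], of "A g"] Apos [of g] by (simp add: abs_mult mult.commute)
  \<comment> \<open>A tail estimate as for the Mills ratio: here \<open>v \<le> -1\<close>, so
    \<open>C * A\<close> grows at least at rate \<open>C * A\<close>, while \<open>P\<close> changes
    at rate at most \<open>C * A\<close>. Both vanish at -infinity. The sign \<open>s\<close> covers
    the two halves of the absolute value.\<close>
  have P_small_bot: "\<bar>P g\<bar> \<le> C * A g" if "g \<le> - (K + 1)" for g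
  proof -
    have "0 \<le> C * A g - s * P g" if s: "s \<in> {1, -1}" for s
    proof (rule DERIV_nonneg_at_bot_lower [where f = "\<lambda>g. C * A g - s * P g"])
      show "((\<lambda>g. C * A g - s * P g) \<longlongrightarrow> 0) at_bot"
        using tendsto_diff [OF tendsto_mult_left [OF A0, of at_bot C] tendsto_mult_left [OF P_bot, of s]]
        by simp
      fix x assume "x \<le> g"
      then have "1 \<le> - v x"
        using \<open>g \<le> - (K + 1)\<close> abs_le_D1 [OF K(2) [of x]] abs_le_D2 [OF K(2) [of x]]
        unfolding v_def by linarith
      then have "C * (1 * A x) \<le> C * (- v x * A x)"
        using C(1) Apos [of x] by (intro mult_left_mono mult_right_mono) auto
      then have "0 \<le> C * (- v x * A x) - s * (A x * F x)"
        using AF [of x] s by (auto simp: abs_le_iff)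
      moreover have "DERIV (\<lambda>g. C * A g - s * P g) x :> C * (- v x * A x) - s * (A x * F x)"
        by (rule DERIV_diff [OF DERIV_cmult [OF A_der] DERIV_cmult [OF P_der]])
      ultimately show "\<exists>y. DERIV (\<lambda>g. C * A g - s * P g) x :> y \<and> 0 \<le> y"
        by blast
    qed
    from this [of 1] this [of "-1"] show ?thesis by (simp add: abs_le_iff)
  qed
  have P_small_top: "\<bar>P g\<bar> \<le> C * A g" if "K + 1 \<le> g" for g
  proof -
    have "0 \<le> C * A g - s * P g" if s: "s \<in> {1, -1}" for s
    proof (rule DERIV_nonpos_at_top_lower [where f = "\<lambda>g. C * A g - s * P g"])
      show "((\<lambda>g. C * A g - s * P g) \<longlongrightarrow> 0) at_top"
        using tendsto_diff [OF tendsto_mult_left [OF A0, of at_top C] tendsto_mult_left [OF P_top, of s]]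
        by simp
      fix x assume "g \<le> x"
      then have "1 \<le> v x"
        using \<open>K + 1 \<le> g\<close> abs_le_D1 [OF K(2) [of x]] abs_le_D2 [OF K(2) [of x]]
        unfolding v_def by linarith
      then have "C * (1 * A x) \<le> C * (v x * A x)"
        using C(1) Apos [of x] by (intro mult_left_mono mult_right_mono) auto
      then have "C * (- v x * A x) - s * (A x * F x) \<le> 0"
        using AF [of x] s by (auto simp: abs_le_iff)
      moreover have "DERIV (\<lambda>g. C * A g - s * P g) x :> C * (- v x * A x) - s * (A x * F x)"
        by (rule DERIV_diff [OF DERIV_cmult [OF A_der] DERIV_cmult [OF P_der]])
      ultimately show "\<exists>y. DERIV (\<lambda>g. C * A g - s * P g) x :> y \<and> y \<le> 0"
        by blast
    qed
    from this [of 1] this [of "-1"] show ?thesis by (simp add: abs_le_iff)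
  qed
  \<comment> \<open>The first term of \<open>T\<close> contributes \<open>\<bar>g\<bar> + K\<close>
    through \<open>v\<close>, and the term \<open>2 * F g * P g\<close> contributes the remaining
    2.\<close>
  have T_bound: "\<bar>T g\<bar> \<le> C\<^sup>2 * ((\<bar>g\<bar> + (K + 2)) * A g)" if P: "\<bar>P g\<bar> \<le> C * A g" for g
  proof -
    have "\<bar>v g\<bar> \<le> \<bar>g\<bar> + K"
      using K(2) [of g] unfolding v_def by linarith
    moreover have "(P g)\<^sup>2 / A g \<le> C\<^sup>2 * A g"
    proof -
      have "(P g)\<^sup>2 \<le> (C * A g)\<^sup>2"
        using P by (metis abs_ge_zero power2_abs power_mono)
      then show ?thesis using Apos [of g] by (simp add: divide_simps power2_eq_square mult_ac)
    qed
    ultimately have "\<bar>v g\<bar> * ((P g)\<^sup>2 / A g) \<le> (\<bar>g\<bar> + K) * (C\<^sup>2 * A g)"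
      using Apos [of g] K(1) by (intro mult_mono) auto
    moreover have "\<bar>F g\<bar> * \<bar>P g\<bar> \<le> C * (C * A g)"
      using C P by (intro mult_mono) auto
    moreover have "\<bar>T g\<bar> \<le> \<bar>v g\<bar> * ((P g)\<^sup>2 / A g) + 2 * (\<bar>F g\<bar> * \<bar>P g\<bar>)"
      unfolding T_def using Apos [of g]
      by (intro order_trans [OF abs_triangle_ineq]) (simp add: abs_mult)
    ultimately show ?thesis by (simp add: algebra_simps power2_eq_square)
  qed
  have T_bot: "(T \<longlongrightarrow> 0) at_bot"
  proof (rule Lim_null_comparison)
    show "((\<lambda>g. C\<^sup>2 * ((\<bar>g\<bar> + (K + 2)) * A g)) \<longlongrightarrow> 0) at_bot"
      using tendsto_mult_left [OF gA [of at_bot "K + 2"], of "C\<^sup>2"] by simp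
    show "\<forall>\<^sub>F g in at_bot. norm (T g) \<le> C\<^sup>2 * ((\<bar>g\<bar> + (K + 2)) * A g)"
      unfolding eventually_at_bot_linorder real_norm_def using T_bound P_small_bot by blast
  qed
  have T_top: "(T \<longlongrightarrow> 0) at_top"
  proof (rule Lim_null_comparison)
    show "((\<lambda>g. C\<^sup>2 * ((\<bar>g\<bar> + (K + 2)) * A g)) \<longlongrightarrow> 0) at_top"
      using tendsto_mult_left [OF gA [of at_top "K + 2"], of "C\<^sup>2"] by simp
    show "\<forall>\<^sub>F g in at_top. norm (T g) \<le> C\<^sup>2 * ((\<bar>g\<bar> + (K + 2)) * A g)"
      unfolding eventually_at_top_linorder real_norm_def using T_bound P_small_top by blast
  qed
  \<comment> \<open>\<open>T - Q\<close> increases from the limit 0 at -infinity. At +infinity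
    \<open>T\<close> vanishes, and the limit of \<open>- Q\<close> that remains is the claim up to
    the factor \<open>L\<close>.\<close>
  have "0 \<le> T g - Q g" for g
    using T_Q tendsto_diff [OF T_bot H_bot [of "\<lambda>x. (\<phi> x)\<^sup>2 - G x"]]
    by (intro DERIV_nonneg_at_bot_lower [where f = "\<lambda>g. T g - Q g"]) (simp_all add: Q_def)
  then have "0 \<le> 0 - (\<Sum>x\<in>X. w x * ((\<phi> x)\<^sup>2 - G x)) * L"
    by (intro tendsto_lowerbound [OF tendsto_diff [OF T_top H_top]]) (simp_all add: Q_def)
  then have "(\<Sum>x\<in>X. w x * ((\<phi> x)\<^sup>2 - G x)) \<le> 0"
    using L by (simp add: mult_le_0_iff)
  then show ?thesis
    by (simp add: right_diff_distrib sum_subtractf)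
qed

text \<open>Subtracting the \<open>w\<close>-mean from \<open>\<phi>\<close> changes none of the
  variances in the hypothesis, which reduces the claim to the centered case.\<close>

lemma gaussian_tilt:
  fixes c a \<phi> G :: "'a \<Rightarrow> real"
  assumes fin: "finite X" "X \<noteq> {}" and pos: "\<forall>x\<in>X. 0 < c x"
    and hyp: "\<And>g t. wvar X (\<lambda>x. c x * exp (g * a x)) (\<lambda>x. \<phi> x + t * a x)
                       \<le> wmean X (\<lambda>x. c x * exp (g * a x)) G + t\<^sup>2"
  shows "wvar X (\<lambda>x. c x * exp ((a x)\<^sup>2 / 2)) \<phi> \<le> wmean X (\<lambda>x. c x * exp ((a x)\<^sup>2 / 2)) G"
proof -
  define w where "w = (\<lambda>x. c x * exp ((a x)\<^sup>2 / 2))"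
  define \<psi> where "\<psi> = (\<lambda>x. \<phi> x - wmean X w \<phi>)"
  have wpos: "\<forall>x\<in>X. 0 < w x" using pos by (simp add: w_def)
  have W: "0 < sum w X" using fin wpos by (intro sum_pos) auto
  have "wvar X (\<lambda>x. c x * exp (g * a x)) (\<lambda>x. \<psi> x + t * a x)
                       \<le> wmean X (\<lambda>x. c x * exp (g * a x)) G + t\<^sup>2" for g t
  proof -
    have "wvar X (\<lambda>x. c x * exp (g * a x)) (\<lambda>x. \<psi> x + t * a x)
        = wvar X (\<lambda>x. c x * exp (g * a x)) (\<lambda>x. (\<phi> x + t * a x) - wmean X w \<phi>)"
      by (simp add: \<psi>_def algebra_simps)
    also have "\<dots> = wvar X (\<lambda>x. c x * exp (g * a x)) (\<lambda>x. \<phi> x + t * a x)"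
      using pos by (intro wvar_shift fin) simp
    finally show ?thesis using hyp by simp
  qed
  moreover have "(\<Sum>x\<in>X. w x * \<psi> x) = 0"
    using W by (simp add: \<psi>_def right_diff_distrib sum_subtractf wmean_def
        sum_divide_distrib [symmetric] sum_distrib_right [symmetric])
  ultimately have "(\<Sum>x\<in>X. w x * (\<psi> x)\<^sup>2) \<le> (\<Sum>x\<in>X. w x * G x)"
    unfolding w_def by (intro gaussian_tilt_centered fin pos)
  then have "wvar X w \<phi> \<le> wmean X w G"
    using W unfolding wvar_def wmean_def [of X w G] \<psi>_def wmean_def [of X w "\<lambda>x. (\<phi> x - wmean X w \<phi>)\<^sup>2"]
    by (intro divide_right_mono) auto
  then show ?thesis by (simp add: w_def)
qed

section \<open>Product measures on the hypercube\<close>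

lemma finite_hypercube: "finite (hypercube :: (real^'n) set)"
proof -
  have "hypercube \<subseteq> vec_lambda ` (UNIV \<rightarrow>\<^sub>E {-1, 1 :: real} :: ('n \<Rightarrow> real) set)"
  proof
    fix x :: "real^'n" assume "x \<in> hypercube"
    then show "x \<in> vec_lambda ` (UNIV \<rightarrow>\<^sub>E {-1, 1 :: real})"
      by (intro image_eqI [where x = "vec_nth x"]) (auto simp: hypercube_def)
  qed
  then show ?thesis
    by (rule finite_subset) (intro finite_imageI finite_PiE, auto)
qed

lemma hypercube_nonempty: "hypercube \<noteq> {}"
proof -
  have "(\<chi> i. 1) \<in> hypercube" by (simp add: hypercube_def)
  then show ?thesis by blast
qed

definition flip :: "'n \<Rightarrow> real^'n \<Rightarrow> real^'n" where
  "flip i x = (\<chi> j. if j = i then - x $ j else x $ j)"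

lemma flip_nth: "flip i x $ j = (if j = i then - x $ j else x $ j)"
  by (simp add: flip_def)

lemma flip_flip [simp]: "flip i (flip i x) = x"
  by (simp add: flip_def vec_eq_iff)

lemma flip_commute: "flip i (flip j x) = flip j (flip i x)"
  by (simp add: flip_def vec_eq_iff)

lemma flip_mem: "flip i x \<in> hypercube \<longleftrightarrow> x \<in> hypercube"
proof -
  have "flip i x $ j \<in> {-1, 1} \<longleftrightarrow> x $ j \<in> {-1, 1}" for j
    by (auto simp: flip_nth)
  then show ?thesis by (simp only: hypercube_def mem_Collect_eq)
qed

lemma inner_flip: "h \<bullet> flip i x = h \<bullet> x - 2 * (h $ i * x $ i)"
proof -
  have "h \<bullet> x - h \<bullet> flip i x = (\<Sum>j\<in>UNIV. if j = i then 2 * (h $ i * x $ i) else 0)"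
    unfolding inner_vec_def sum_subtractf [symmetric]
    by (intro sum.cong) (auto simp: flip_nth)
  then show ?thesis by simp
qed

lemma sum_flip: "(\<Sum>x\<in>hypercube. f (flip i x)) = (\<Sum>x\<in>hypercube. f x)"
  by (rule sum.reindex_bij_witness [where i = "flip i" and j = "flip i"]) (auto simp: flip_mem)

text \<open>Two points of the cube are joined by flipping, one at a time, the coordinates in which
  they differ.\<close>

lemma flip_invariant_constant:
  assumes inv: "\<And>i x. x \<in> hypercube \<Longrightarrow> g (flip i x) = g x"
    and x: "x \<in> hypercube" and y: "y \<in> hypercube"
  shows "g x = (g y :: 'a)"
proof -
  have "finite S \<Longrightarrow> x \<in> hypercube \<Longrightarrow> {i. x $ i \<noteq> y $ i} = S \<Longrightarrow> g x = g y" for S x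
  proof (induction S arbitrary: x rule: finite_induct)
    case empty
    then have "x = y" by (simp add: vec_eq_iff)
    then show ?case by simp
  next
    case (insert i S)
    then have "x $ i \<noteq> y $ i" by auto
    moreover have "x $ i \<in> {-1, 1}" "y $ i \<in> {-1, 1}"
      using insert.prems(1) y unfolding hypercube_def by blast+
    ultimately have "- x $ i = y $ i" by auto
    then have "{j. flip i x $ j \<noteq> y $ j} = {j. x $ j \<noteq> y $ j} - {i}"
      by (auto simp: flip_nth)
    then have "{j. flip i x $ j \<noteq> y $ j} = S"
      using insert by simp
    then show ?case
      using insert.IH [of "flip i x"] insert.prems(1) inv by (simp add: flip_mem)
  qed
  from this [of "{i. x $ i \<noteq> y $ i}" x] x show ?thesis by simp
qed

text \<open>Each coordinate average is an orthogonal projection, so the squared error of the composition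
  of averages is at most the sum of the individual squared errors.\<close>

lemma Efron_Stein_aux:
  fixes h :: "real^'n" and f :: "real^'n \<Rightarrow> real"
  defines "w \<equiv> \<lambda>x. exp (h \<bullet> x)"
  assumes S: "finite S"
    and e: "\<And>i x. x \<in> hypercube \<Longrightarrow> e i (flip i x) = e i x"
  shows "\<exists>g. (\<forall>i\<in>S. \<forall>x\<in>hypercube. g (flip i x) = g x) \<and>
    (\<Sum>x\<in>hypercube. w x * (f x - g x)\<^sup>2) \<le> (\<Sum>i\<in>S. \<Sum>x\<in>hypercube. w x * (f x - e i x)\<^sup>2)"
  using S
proof (induction S)
  case empty
  show ?case by (intro exI [of _ f]) simp
next
  case (insert i S)
  then obtain g where g_inv: "\<And>j x. j \<in> S \<Longrightarrow> x \<in> hypercube \<Longrightarrow> g (flip j x) = g x"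
    and g_le: "(\<Sum>x\<in>hypercube. w x * (f x - g x)\<^sup>2) \<le> (\<Sum>i\<in>S. \<Sum>x\<in>hypercube. w x * (f x - e i x)\<^sup>2)"
    by blast
  define p where "p x = w x / (w x + w (flip i x))" for x
  \<comment> \<open>\<open>T\<close> averages over coordinate \<open>i\<close> with the others
    fixed: the conditional expectation under the product weight.\<close>
  define T where "T k x = p x * k x + p (flip i x) * k (flip i x)" for k :: "real^'n \<Rightarrow> real" and x
  have w: "0 < w x" for x by (simp add: w_def)
  \<comment> \<open>By the product form, \<open>p x\<close> depends on \<open>x\<close> through
    \<open>x $ i\<close> alone. Hence \<open>T\<close> preserves invariance under the other
    flips.\<close>
  have p_flip: "p (flip j x) = p x" if "j \<noteq> i" for j x
  proof -
    have "p x = 1 / (1 + exp (- 2 * (h $ i * x $ i)))" for x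
    proof -
      have "w (flip i x) = w x * exp (- 2 * (h $ i * x $ i))"
        by (simp add: w_def inner_flip exp_add [symmetric])
      then have "w x + w (flip i x) = w x * (1 + exp (- 2 * (h $ i * x $ i)))"
        by (simp add: algebra_simps)
      then show ?thesis using w [of x] by (simp add: p_def)
    qed
    then show ?thesis using that by (simp add: flip_nth)
  qed
  have T_inv: "T k (flip i x) = T k x" for k x
    by (simp add: T_def)
  \<comment> \<open>Pairing \<open>x\<close> with \<open>flip i x\<close> makes each pair of terms
    cancel.\<close>
  have ortho: "(\<Sum>x\<in>hypercube. w x * ((k x - T k x) * r x)) = 0"
    if r: "\<And>x. x \<in> hypercube \<Longrightarrow> r (flip i x) = r x" for k r
  proof -
    have "2 * (\<Sum>x\<in>hypercube. w x * ((k x - T k x) * r x))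
        = (\<Sum>x\<in>hypercube. w x * ((k x - T k x) * r x) + w (flip i x) * ((k (flip i x) - T k (flip i x)) * r (flip i x)))"
      using sum_flip [of "\<lambda>x. w x * ((k x - T k x) * r x)" i] by (simp add: sum.distrib)
    also have "\<dots> = 0"
    proof (intro sum.neutral ballI)
      fix x :: "real^'n" assume x: "x \<in> hypercube"
      have "(w x + w (flip i x)) * T k x = w x * k x + w (flip i x) * k (flip i x)"
      proof -
        have "T k x = (w x * k x + w (flip i x) * k (flip i x)) / (w x + w (flip i x))"
          by (simp add: T_def p_def add_divide_distrib add.commute)
        then show ?thesis
          using w [of x] w [of "flip i x"] by simp
      qed
      then have "(w x * (k x - T k x) + w (flip i x) * (k (flip i x) - T k x)) * r x = 0"
        by (simp add: algebra_simps)
      then show "w x * ((k x - T k x) * r x) + w (flip i x) * ((k (flip i x) - T k (flip i x)) * r (flip i x)) = 0"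
        by (simp add: T_inv r [OF x] algebra_simps)
    qed
    finally show ?thesis by simp
  qed
  have pyth: "(\<Sum>x\<in>hypercube. w x * (k x - r x)\<^sup>2)
      = (\<Sum>x\<in>hypercube. w x * (k x - T k x)\<^sup>2) + (\<Sum>x\<in>hypercube. w x * (T k x - r x)\<^sup>2)"
    if r: "\<And>x. x \<in> hypercube \<Longrightarrow> r (flip i x) = r x" for k r
  proof -
    have "(\<Sum>x\<in>hypercube. w x * ((k x - T k x) * (T k x - r x))) = 0"
      by (rule ortho) (simp add: T_inv r)
    moreover have "w x * (k x - r x)\<^sup>2 = w x * (k x - T k x)\<^sup>2 + w x * (T k x - r x)\<^sup>2
        + 2 * (w x * ((k x - T k x) * (T k x - r x)))" for x
      by (simp add: power2_eq_square algebra_simps)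
    ultimately show ?thesis
      by (simp add: sum.distrib sum_distrib_left [symmetric])
  qed
  have T_diff: "T (\<lambda>x. f x - g x) x = T f x - T g x" for x
    by (simp add: T_def algebra_simps)
  have sq_nonneg: "0 \<le> (\<Sum>x\<in>hypercube. w x * (k x)\<^sup>2)" for k :: "real^'n \<Rightarrow> real"
    using w by (intro sum_nonneg) (simp add: less_imp_le)
  \<comment> \<open>Split \<open>f - T g\<close> orthogonally into \<open>f - T f\<close> and
    \<open>T (f - g)\<close>. The first is the smallest error among functions free of coordinate
    \<open>i\<close>; in the second, \<open>T\<close> is a contraction.\<close>
  have "(\<Sum>x\<in>hypercube. w x * (f x - T g x)\<^sup>2)
      = (\<Sum>x\<in>hypercube. w x * (f x - T f x)\<^sup>2) + (\<Sum>x\<in>hypercube. w x * (T f x - T g x)\<^sup>2)"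
    by (rule pyth) (rule T_inv)
  also have "\<dots> \<le> (\<Sum>x\<in>hypercube. w x * (f x - e i x)\<^sup>2) + (\<Sum>x\<in>hypercube. w x * (f x - g x)\<^sup>2)"
  proof (rule add_mono)
    show "(\<Sum>x\<in>hypercube. w x * (f x - T f x)\<^sup>2) \<le> (\<Sum>x\<in>hypercube. w x * (f x - e i x)\<^sup>2)"
      using pyth [of "e i" f] e sq_nonneg by simp
    show "(\<Sum>x\<in>hypercube. w x * (T f x - T g x)\<^sup>2) \<le> (\<Sum>x\<in>hypercube. w x * (f x - g x)\<^sup>2)"
      using pyth [of "\<lambda>x. 0" "\<lambda>x. f x - g x"]
        sq_nonneg [of "\<lambda>x. f x - g x - (T f x - T g x)"]
      by (simp add: T_diff)
  qed
  also have "\<dots> \<le> (\<Sum>i\<in>insert i S. \<Sum>x\<in>hypercube. w x * (f x - e i x)\<^sup>2)"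
    using g_le insert.hyps by simp
  finally have "(\<Sum>x\<in>hypercube. w x * (f x - T g x)\<^sup>2)
      \<le> (\<Sum>i\<in>insert i S. \<Sum>x\<in>hypercube. w x * (f x - e i x)\<^sup>2)" .
  moreover have "T g (flip j x) = T g x" if j: "j \<in> insert i S" and x: "x \<in> hypercube" for j x
  proof (cases "j = i")
    case False
    then show ?thesis
      using j x g_inv [of j x] g_inv [of j "flip i x"] p_flip [of j x] p_flip [of j "flip i x"]
      by (simp add: T_def flip_commute [of i j] flip_mem)
  qed (simp add: T_inv)
  ultimately show ?case by blast
qed

text \<open>Averaging over all coordinates leaves a flip-invariant, hence constant, approximant. The
  \<open>e i\<close> need not be conditional expectations of this product measure, so the same
  family serves every field \<open>h\<close>.\<close>

lemma Efron_Stein: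
  fixes h :: "real^'n" and f :: "real^'n \<Rightarrow> real"
  assumes e: "\<And>i x. x \<in> hypercube \<Longrightarrow> e i (flip i x) = e i x"
  shows "wvar hypercube (\<lambda>x. exp (h \<bullet> x)) f
           \<le> wmean hypercube (\<lambda>x. exp (h \<bullet> x)) (\<lambda>x. \<Sum>i\<in>UNIV. (f x - e i x)\<^sup>2)"
proof -
  obtain g where "\<forall>i\<in>UNIV. \<forall>x\<in>hypercube. g (flip i x) = g x"
    and g_le: "(\<Sum>x\<in>hypercube. exp (h \<bullet> x) * (f x - g x)\<^sup>2)
                 \<le> (\<Sum>i\<in>UNIV. \<Sum>x\<in>hypercube. exp (h \<bullet> x) * (f x - e i x)\<^sup>2)"
    using Efron_Stein_aux [of UNIV e h f] e by fastforce
  then have g_inv: "\<And>i x. x \<in> hypercube \<Longrightarrow> g (flip i x) = g x" by blast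
  obtain y :: "real^'n" where y: "y \<in> hypercube" using hypercube_nonempty by blast
  have "wvar hypercube (\<lambda>x. exp (h \<bullet> x)) f \<le> wmean hypercube (\<lambda>x. exp (h \<bullet> x)) (\<lambda>x. (f x - g y)\<^sup>2)"
    by (intro wvar_le finite_hypercube hypercube_nonempty) simp
  also have "\<dots> = wmean hypercube (\<lambda>x. exp (h \<bullet> x)) (\<lambda>x. (f x - g x)\<^sup>2)"
    using flip_invariant_constant [of g, OF g_inv _ y] by (intro wmean_cong) simp
  also have "\<dots> \<le> wmean hypercube (\<lambda>x. exp (h \<bullet> x)) (\<lambda>x. \<Sum>i\<in>UNIV. (f x - e i x)\<^sup>2)"
  proof -
    have "(\<Sum>i\<in>UNIV. \<Sum>x\<in>hypercube. exp (h \<bullet> x) * (f x - e i x)\<^sup>2)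
       = (\<Sum>x\<in>hypercube. exp (h \<bullet> x) * (\<Sum>i\<in>UNIV. (f x - e i x)\<^sup>2))"
      unfolding sum_distrib_left by (rule sum.swap)
    with g_le show ?thesis
      unfolding wmean_def by (intro divide_right_mono) (auto intro: sum_nonneg)
  qed
  finally show ?thesis .
qed

section \<open>Quadratic interactions\<close>

text \<open>Lagrange reduction: a nonzero diagonal entry allows one square to be split off, and the
  Schur complement has fewer nonzero diagonal entries.\<close>

lemma psd_sum_of_squares:
  fixes J :: "real^'n^'n"
  assumes "transpose J = J" and "\<And>x. 0 \<le> x \<bullet> (J *v x)"
  shows "\<exists>m (u :: nat \<Rightarrow> real^'n). \<forall>x. x \<bullet> (J *v x) = (\<Sum>k<m. (u k \<bullet> x)\<^sup>2)"
  using assms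
proof (induction "card {i. J $ i $ i \<noteq> 0}" arbitrary: J rule: less_induct)
  case less
  have sym: "x \<bullet> (J *v y) = y \<bullet> (J *v x)" for x y
    by (metis dot_lmul_matrix inner_commute less.prems(1) transpose_matrix_vector)
  have diag: "axis i 1 \<bullet> (J *v axis i 1) = J $ i $ i" for i
    by (simp add: inner_axis' matrix_vector_mult_basis column_def)
  have quad: "(x + s *\<^sub>R y) \<bullet> (J *v (x + s *\<^sub>R y))
      = x \<bullet> (J *v x) + 2 * s * (y \<bullet> (J *v x)) + s\<^sup>2 * (y \<bullet> (J *v y))" for x y s
    using sym [of x y]
    by (simp add: matrix_vector_right_distrib matrix_vector_mult_scaleR inner_add_left inner_add_right
        power2_eq_square algebra_simps)
  show ?case
  proof (cases "\<forall>i. J $ i $ i = 0")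
    case True
    have "(J *v x) $ i = 0" for x i
    proof -
      define b where "b = (J *v x) $ i"
      have b: "axis i 1 \<bullet> (J *v x) = b"
        by (simp add: b_def inner_axis')
      define q where "q = x \<bullet> (J *v x)"
      \<comment> \<open>An affine function of \<open>s\<close> that is bounded below has slope zero;
        the value of \<open>s\<close> inserted below would make it -1.\<close>
      have pos: "0 \<le> q + 2 * s * b" for s
        using less.prems(2) [of "x + s *\<^sub>R axis i 1"] True by (simp add: quad diag b q_def)
      have "b = 0"
      proof (rule ccontr)
        assume "b \<noteq> 0"
        then show False using pos [of "- (q + 1) / (2 * b)"] by (simp add: field_simps)
      qed
      then show ?thesis by (simp add: b_def)
    qed
    then have "x \<bullet> (J *v x) = (\<Sum>k<0. (0 \<bullet> x)\<^sup>2)" for x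
      by (simp add: inner_vec_def)
    then show ?thesis by (intro exI [of _ 0] exI [of _ "\<lambda>_. 0"]) simp
  next
    case False
    then obtain i where i: "J $ i $ i \<noteq> 0" by blast
    define d where "d = J $ i $ i"
    have d: "0 < d"
      using less.prems(2) [of "axis i 1"] i by (simp add: diag d_def)
    define b where "b = J *v axis i 1"
    have b_inner: "b \<bullet> x = axis i 1 \<bullet> (J *v x)" for x
      using sym [of x "axis i 1"] by (simp add: b_def inner_commute)
    have b_nth: "b $ j = J $ j $ i" for j
      by (simp add: b_def matrix_vector_mult_basis column_def)
    define J' where "J' = (\<chi> j k. J $ j $ k - b $ j * b $ k / d)"
    have "(J' *v x) $ j = (J *v x) $ j - b $ j * (b \<bullet> x) / d" for x j
      by (simp add: J'_def matrix_vector_mult_def inner_vec_def left_diff_distrib sum_subtractf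
          sum_distrib_left sum_divide_distrib mult.assoc)
    then have J'_vec: "J' *v x = J *v x - ((b \<bullet> x) / d) *\<^sub>R b" for x
      by (simp add: vec_eq_iff)
    have J'_quad: "x \<bullet> (J' *v x) = x \<bullet> (J *v x) - (b \<bullet> x)\<^sup>2 / d" for x
      by (simp add: J'_vec inner_diff_right power2_eq_square inner_commute)
    have J'_psd: "0 \<le> x \<bullet> (J' *v x)" for x
    proof -
      \<comment> \<open>The shift minimises the quadratic form of \<open>J\<close> along the
        \<open>i\<close>-th axis, and the minimum is the form of \<open>J'\<close>.\<close>
      have "0 \<le> x \<bullet> (J *v x) + 2 * (- (b \<bullet> x) / d) * (b \<bullet> x) + (- (b \<bullet> x) / d)\<^sup>2 * d"
        using less.prems(2) [of "x + (- (b \<bullet> x) / d) *\<^sub>R axis i 1"]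
        unfolding quad diag b_inner [symmetric] d_def by simp
      also have "\<dots> = x \<bullet> (J' *v x)"
        using d by (simp add: J'_quad power2_eq_square field_simps)
      finally show ?thesis .
    qed
    have J_sym: "J $ j $ k = J $ k $ j" for j k
      using less.prems(1) by (metis transpose_def vec_lambda_beta)
    have J'_sym: "transpose J' = J'"
      by (simp add: transpose_def J'_def vec_eq_iff J_sym mult.commute)
    have J'_diag: "J' $ j $ j = J $ j $ j - (b $ j)\<^sup>2 / d" for j
      by (simp add: J'_def power2_eq_square)
    \<comment> \<open>Diagonal entries do not increase and stay nonnegative, so zeros persist, while
      the \<open>i\<close>-th entry becomes zero.\<close>
    have "{j. J' $ j $ j \<noteq> 0} \<subset> {j. J $ j $ j \<noteq> 0}"
    proof
      show "{j. J' $ j $ j \<noteq> 0} \<subseteq> {j. J $ j $ j \<noteq> 0}"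
      proof (clarify)
        fix j assume "J' $ j $ j \<noteq> 0" "J $ j $ j = 0"
        moreover have "0 \<le> J' $ j $ j"
          using J'_psd [of "axis j 1"] by (simp add: inner_axis' matrix_vector_mult_basis column_def)
        moreover have "0 \<le> (b $ j)\<^sup>2 / d" using d by simp
        ultimately show False using J'_diag [of j] by linarith
      qed
      have "J' $ i $ i = 0"
        using d by (simp add: J'_diag b_nth power2_eq_square flip: d_def)
      then show "{j. J' $ j $ j \<noteq> 0} \<noteq> {j. J $ j $ j \<noteq> 0}" using i by blast
    qed
    then have "card {j. J' $ j $ j \<noteq> 0} < card {j. J $ j $ j \<noteq> 0}"
      by (intro psubset_card_mono) auto
    then obtain m and u :: "nat \<Rightarrow> real^'n"
      where u: "\<And>x. x \<bullet> (J' *v x) = (\<Sum>k<m. (u k \<bullet> x)\<^sup>2)"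
      using less.hyps [OF _ J'_sym J'_psd] by blast
    have "x \<bullet> (J *v x) = (\<Sum>k<Suc m. ((u(m := (1 / sqrt d) *\<^sub>R b)) k \<bullet> x)\<^sup>2)" for x
      using u [of x] d by (simp add: J'_quad power_mult_distrib power_divide)
    then show ?thesis by blast
  qed
qed

text \<open>Synthesis from the coefficients \<open>t\<close> is the adjoint of the map taking
  \<open>x\<close> to the numbers \<open>u k \<bullet> x\<close>, so it obeys the same norm
  bound.\<close>

lemma norm_sum_scaleR_squares_le:
  fixes u :: "nat \<Rightarrow> 'a::real_inner"
  assumes "\<And>x. (\<Sum>k<m. (u k \<bullet> x)\<^sup>2) \<le> L * (norm x)\<^sup>2" and "0 \<le> L"
  shows "(norm (\<Sum>k<m. t k *\<^sub>R u k))\<^sup>2 \<le> L * (\<Sum>k<m. (t k)\<^sup>2)"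
proof -
  define y where "y = (\<Sum>k<m. t k *\<^sub>R u k)"
  have "(norm y)\<^sup>2 = (\<Sum>k<m. t k * (u k \<bullet> y))"
    by (simp add: power2_norm_eq_inner) (simp add: y_def inner_sum_left)
  then have "((norm y)\<^sup>2)\<^sup>2 \<le> (\<Sum>k<m. (t k)\<^sup>2) * (\<Sum>k<m. (u k \<bullet> y)\<^sup>2)"
    using Cauchy_Schwarz_ineq_sum [of t "\<lambda>k. u k \<bullet> y" "{..<m}"] by simp
  also have "\<dots> \<le> (\<Sum>k<m. (t k)\<^sup>2) * (L * (norm y)\<^sup>2)"
    by (intro mult_left_mono assms sum_nonneg) simp
  finally have "(norm y)\<^sup>2 * (norm y)\<^sup>2 \<le> (L * (\<Sum>k<m. (t k)\<^sup>2)) * (norm y)\<^sup>2"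
    by (simp add: power2_eq_square mult_ac)
  moreover have "0 \<le> L * (\<Sum>k<m. (t k)\<^sup>2)"
    using assms(2) by (intro mult_nonneg_nonneg sum_nonneg) auto
  ultimately show ?thesis
    unfolding y_def [symmetric]
    by (cases "y = 0") (auto intro: mult_right_le_imp_le [where c = "(norm y)\<^sup>2"])
qed

text \<open>In the induction step \<open>\<phi>\<close> and \<open>G\<close> are replaced by \<open>\<phi> + s (u m \<bullet> x)\<close> and \<open>G + s\<^sup>2\<close>; this is why the
  hypothesis carries the whole family of linear perturbations.\<close>

lemma wvar_quadratic_tilt:
  fixes u :: "nat \<Rightarrow> real^'n" and \<phi> G :: "real^'n \<Rightarrow> real"
  assumes "\<And>h t. wvar hypercube (\<lambda>x. exp (h \<bullet> x)) (\<lambda>x. \<phi> x + (\<Sum>k<m. t k *\<^sub>R u k) \<bullet> x)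
                   \<le> wmean hypercube (\<lambda>x. exp (h \<bullet> x)) G + (\<Sum>k<m. (t k)\<^sup>2)"
  shows "wvar hypercube (\<lambda>x. exp ((\<Sum>k<m. (u k \<bullet> x)\<^sup>2) / 2 + h \<bullet> x)) \<phi>
           \<le> wmean hypercube (\<lambda>x. exp ((\<Sum>k<m. (u k \<bullet> x)\<^sup>2) / 2 + h \<bullet> x)) G"
  using assms
proof (induction m arbitrary: \<phi> G h)
  case 0
  then show ?case by simp
next
  case (Suc m)
  define c where "c = (\<lambda>h x. exp ((\<Sum>k<m. (u k \<bullet> x)\<^sup>2) / 2 + h \<bullet> x))"
  have "wvar hypercube (\<lambda>x. c h x * exp (g * (u m \<bullet> x))) (\<lambda>x. \<phi> x + s * (u m \<bullet> x))
          \<le> wmean hypercube (\<lambda>x. c h x * exp (g * (u m \<bullet> x))) G + s\<^sup>2" for g s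
  proof -
    have "wvar hypercube (c (h + g *\<^sub>R u m)) (\<lambda>x. \<phi> x + s * (u m \<bullet> x))
          \<le> wmean hypercube (c (h + g *\<^sub>R u m)) (\<lambda>x. G x + s\<^sup>2)"
      unfolding c_def
    proof (rule Suc.IH)
      fix h' and t :: "nat \<Rightarrow> real"
      have "(\<lambda>x. \<phi> x + s * (u m \<bullet> x) + (\<Sum>k<m. t k *\<^sub>R u k) \<bullet> x)
          = (\<lambda>x. \<phi> x + (\<Sum>k<Suc m. (t(m := s)) k *\<^sub>R u k) \<bullet> x)"
        by (simp add: inner_add_left algebra_simps)
      moreover have "(\<Sum>k<Suc m. ((t(m := s)) k)\<^sup>2) = (\<Sum>k<m. (t k)\<^sup>2) + s\<^sup>2"
        by simp
      moreover have "wmean hypercube (\<lambda>x. exp (h' \<bullet> x)) (\<lambda>x. G x + s\<^sup>2)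
          = wmean hypercube (\<lambda>x. exp (h' \<bullet> x)) G + s\<^sup>2"
        by (simp add: wmean_add wmean_const finite_hypercube hypercube_nonempty)
      ultimately show "wvar hypercube (\<lambda>x. exp (h' \<bullet> x)) (\<lambda>x. \<phi> x + s * (u m \<bullet> x) + (\<Sum>k<m. t k *\<^sub>R u k) \<bullet> x)
          \<le> wmean hypercube (\<lambda>x. exp (h' \<bullet> x)) (\<lambda>x. G x + s\<^sup>2) + (\<Sum>k<m. (t k)\<^sup>2)"
        using Suc.prems [of h' "t(m := s)"] by simp
    qed
    \<comment> \<open>A tilt along \<open>u m\<close> only shifts the field, which is why the
      induction runs over arbitrary \<open>h\<close>.\<close>
    moreover have "c (h + g *\<^sub>R u m) = (\<lambda>x. c h x * exp (g * (u m \<bullet> x)))"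
      by (simp add: c_def inner_add_left exp_add [symmetric] add_ac)
    ultimately show ?thesis
      by (simp add: wmean_add wmean_const finite_hypercube hypercube_nonempty c_def)
  qed
  then have "wvar hypercube (\<lambda>x. c h x * exp ((u m \<bullet> x)\<^sup>2 / 2)) \<phi>
      \<le> wmean hypercube (\<lambda>x. c h x * exp ((u m \<bullet> x)\<^sup>2 / 2)) G"
    by (intro gaussian_tilt finite_hypercube hypercube_nonempty) (auto simp: c_def)
  moreover have "(\<lambda>x. c h x * exp ((u m \<bullet> x)\<^sup>2 / 2)) = (\<lambda>x. exp ((\<Sum>k<Suc m. (u k \<bullet> x)\<^sup>2) / 2 + h \<bullet> x))"
    by (simp add: c_def exp_add [symmetric] add_divide_distrib add_ac)
  ultimately show ?case by simp
qed

section \<open>The Ising measure\<close>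

lemma integral_ising_measure:
  fixes J :: "real^'n^'n"
  shows "(\<integral>x. f x \<partial>ising_measure J h) = wmean hypercube (ising_weight J h) f"
proof -
  have meas: "k \<in> borel_measurable cube_uniform" for k :: "real^'n \<Rightarrow> real"
    by (simp add: cube_uniform_def uniform_count_measure_def measurable_point_measure_eq1)
  have int: "(\<integral>x. k x \<partial>cube_uniform) = (\<Sum>x\<in>hypercube. k x) / card (hypercube :: (real^'n) set)"
    for k :: "real^'n \<Rightarrow> real"
    by (simp add: cube_uniform_def integral_uniform_count_measure finite_hypercube)
  have card: "0 < card (hypercube :: (real^'n) set)"
    by (simp add: card_gt_0_iff finite_hypercube hypercube_nonempty)
  have Z: "ising_Z J h = (\<Sum>x\<in>hypercube. ising_weight J h x) / card (hypercube :: (real^'n) set)"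
    by (simp add: ising_Z_def int)
  have "0 \<le> ising_Z J h"
    unfolding Z by (intro divide_nonneg_nonneg sum_nonneg) (simp_all add: ising_weight_def)
  then have "(\<integral>x. f x \<partial>ising_measure J h)
      = (\<integral>x. (1 / ising_Z J h * ising_weight J h x) *\<^sub>R f x \<partial>cube_uniform)"
    unfolding ising_measure_def by (intro integral_density meas) (simp add: ising_weight_def)
  also have "\<dots> = (\<Sum>x\<in>hypercube. ising_weight J h x * f x) / (ising_Z J h * card (hypercube :: (real^'n) set))"
    by (simp add: int sum_divide_distrib mult_ac)
  also have "\<dots> = wmean hypercube (ising_weight J h) f"
    using card by (simp add: wmean_def Z)
  finally show ?thesis .
qed

text \<open>The level set of \<open>f\<close> at \<open>f x\<close> is a preimage under the map that
  forgets coordinate \<open>i\<close>, and this map does not see the flip. Thus conditional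
  expectations satisfy the invariance in \<open>Efron_Stein\<close> at every point, whichever
  version is taken.\<close>

lemma sigma_except_flip_invariant:
  fixes f :: "real^'n \<Rightarrow> real"
  assumes f: "f \<in> borel_measurable (sigma_except i)" and x: "x \<in> hypercube"
  shows "f (flip i x) = f x"
proof -
  let ?X = "\<lambda>x :: real^'n. \<lambda>j\<in>-{i}. x $ j"
  have "?X \<in> hypercube \<rightarrow> space (PiM (-{i}) (\<lambda>_. count_space {-1, 1}))"
    by (auto simp: space_PiM hypercube_def)
  then have sets: "sets (sigma_except i) =
      {?X -` A \<inter> hypercube |A. A \<in> sets (PiM (-{i}) (\<lambda>_. count_space {-1, 1}))}"
    unfolding sigma_except_def by (rule sets_vimage_algebra2)
  have "f -` {f x} \<inter> space (sigma_except i) \<in> sets (sigma_except i)"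
    using f by (rule measurable_sets) simp
  then obtain A where A: "f -` {f x} \<inter> hypercube = ?X -` A \<inter> hypercube"
    unfolding sets by (auto simp: sigma_except_def)
  have "?X (flip i x) = ?X x"
    by (auto simp: flip_nth)
  moreover have "x \<in> ?X -` A \<inter> hypercube"
    unfolding A [symmetric] using x by simp
  ultimately have "flip i x \<in> ?X -` A \<inter> hypercube"
    using x by (simp add: flip_mem)
  then show ?thesis unfolding A [symmetric] by simp
qed

text \<open>Convexity of the square at \<open>a / (1 - l)\<close> and \<open>b / l\<close> with
  weights \<open>1 - l\<close> and \<open>l\<close>.\<close>

lemma power2_add_le_weighted:
  fixes a b l :: real
  assumes "0 < l" "l < 1"
  shows "(a + b)\<^sup>2 \<le> a\<^sup>2 / (1 - l) + b\<^sup>2 / l"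
proof -
  have "a\<^sup>2 / (1 - l) + b\<^sup>2 / l - (a + b)\<^sup>2 = (l * a - (1 - l) * b)\<^sup>2 / (l * (1 - l))"
    using assms by (simp add: divide_simps) (simp add: power2_eq_square algebra_simps)
  also have "\<dots> \<ge> 0" using assms by simp
  finally show ?thesis by simp
qed

theorem theorem1:
  fixes J :: "real^'n^'n" and h :: "real^'n" and \<phi> :: "real^'n \<Rightarrow> real"
  assumes "transpose J = J"
    and "loewner_le 0 J" and "loewner_less J (mat 1)"
  shows "(1 - op_norm J) * prob_space.variance (ising_measure J h) \<phi>
           \<le> dirichlet_form (ising_measure J h) \<phi>"
proof -
  define l where "l = op_norm J"
  define e where "e i = real_cond_exp (ising_measure J h) (sigma_except i) \<phi>" for i
  define w where "w = ising_weight J h"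
  define D where "D x = (\<Sum>i\<in>UNIV. (\<phi> x - e i x)\<^sup>2)" for x
  have bl: "bounded_linear (\<lambda>x. J *v x)"
    by (rule matrix_vector_mul_bounded_linear)
  have l0: "0 \<le> l"
    unfolding l_def op_norm_def using bl by (rule onorm_pos_le)
  have e_flip: "e i (flip i x) = e i x" if "x \<in> hypercube" for i x
    unfolding e_def using that by (intro sigma_except_flip_invariant) auto
  have wpos: "\<forall>x\<in>hypercube. 0 < w x"
    by (simp add: w_def ising_weight_def)
  have var: "prob_space.variance (ising_measure J h) \<phi> = wvar hypercube w \<phi>"
    by (simp add: integral_ising_measure wvar_def w_def)
  have dir: "dirichlet_form (ising_measure J h) \<phi> = wmean hypercube w D"
    unfolding dirichlet_form_def integral_ising_measure w_def
    by (rule wmean_cong) (simp add: D_def e_def power2_commute)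
  have D0: "0 \<le> wmean hypercube w D"
    using wmean_mono [of hypercube w "\<lambda>_. 0" D] wpos by (simp add: D_def sum_nonneg wmean_def)
  have V0: "0 \<le> wvar hypercube w \<phi>"
    using wmean_mono [of hypercube w "\<lambda>_. 0"] wpos by (simp add: wvar_def wmean_def)
  show ?thesis
  proof (cases "l < 1")
    case False
    then have "(1 - l) * wvar hypercube w \<phi> \<le> 0"
      using V0 by (simp add: mult_nonpos_nonneg)
    then show ?thesis using D0 by (simp add: var dir l_def)
  next
    case True
    obtain m and u :: "nat \<Rightarrow> real^'n" where u: "\<And>x. x \<bullet> (J *v x) = (\<Sum>k<m. (u k \<bullet> x)\<^sup>2)"
      using psd_sum_of_squares [of J] assms(1,2) by (auto simp: loewner_le_def)
    have u_bound: "(\<Sum>k<m. (u k \<bullet> x)\<^sup>2) \<le> l * (norm x)\<^sup>2" for x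
    proof -
      have "x \<bullet> (J *v x) \<le> norm x * norm (J *v x)"
        by (rule norm_cauchy_schwarz)
      also have "\<dots> \<le> norm x * (l * norm x)"
        unfolding l_def op_norm_def by (intro mult_left_mono onorm bl norm_ge_zero)
      finally show ?thesis by (simp add: u power2_eq_square mult_ac)
    qed
    have "wvar hypercube (\<lambda>x. exp ((\<Sum>k<m. (u k \<bullet> x)\<^sup>2) / 2 + h \<bullet> x)) \<phi>
        \<le> wmean hypercube (\<lambda>x. exp ((\<Sum>k<m. (u k \<bullet> x)\<^sup>2) / 2 + h \<bullet> x)) (\<lambda>x. 1 / (1 - l) * D x)"
    proof (rule wvar_quadratic_tilt)
      fix h :: "real^'n" and t :: "nat \<Rightarrow> real"
      define y where "y = (\<Sum>k<m. t k *\<^sub>R u k)"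
      define \<tau> where "\<tau> = (\<Sum>k<m. (t k)\<^sup>2)"
      have y: "(norm y)\<^sup>2 \<le> l * \<tau>"
        unfolding y_def \<tau>_def using u_bound l0 by (rule norm_sum_scaleR_squares_le)
      have norm_y: "(norm y)\<^sup>2 = (\<Sum>i\<in>UNIV. (y $ i)\<^sup>2)"
        unfolding power2_norm_eq_inner inner_vec_def by (simp add: power2_eq_square)
      have \<tau>0: "0 \<le> \<tau>" by (simp add: \<tau>_def sum_nonneg)
      \<comment> \<open>Dropping the \<open>i\<close>-th term of \<open>y \<bullet> x\<close> keeps
        \<open>e' i\<close> free of coordinate \<open>i\<close> and leaves
        \<open>y $ i * x $ i\<close> in the error.\<close>
      define e' where "e' i x = e i x + (y \<bullet> x - y $ i * x $ i)" for i x
      have "wvar hypercube (\<lambda>x. exp (h \<bullet> x)) (\<lambda>x. \<phi> x + y \<bullet> x)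
          \<le> wmean hypercube (\<lambda>x. exp (h \<bullet> x)) (\<lambda>x. \<Sum>i\<in>UNIV. (\<phi> x + y \<bullet> x - e' i x)\<^sup>2)"
        by (rule Efron_Stein) (simp add: e'_def e_flip inner_flip flip_nth)
      also have "\<dots> \<le> wmean hypercube (\<lambda>x. exp (h \<bullet> x)) (\<lambda>x. 1 / (1 - l) * D x + \<tau>)"
      proof (rule wmean_mono)
        fix x :: "real^'n" assume x: "x \<in> hypercube"
        have e': "\<phi> x + y \<bullet> x - e' i x = (\<phi> x - e i x) + y $ i * x $ i" for i
          by (simp add: e'_def)
        show "(\<Sum>i\<in>UNIV. (\<phi> x + y \<bullet> x - e' i x)\<^sup>2) \<le> 1 / (1 - l) * D x + \<tau>"
        \<comment> \<open>The weighted inequality divides by \<open>l\<close>; for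
          \<open>l = 0\<close> the perturbation \<open>y\<close> itself vanishes.\<close>
        proof (cases "l = 0")
          case True
          then have "y = 0" using y by simp
          then show ?thesis using \<tau>0 \<open>l = 0\<close> unfolding e' D_def by simp
        next
          case False
          have sq: "(x $ i)\<^sup>2 = 1" for i
          proof -
            have "x $ i \<in> {-1, 1}" using x unfolding hypercube_def by blast
            then show ?thesis by auto
          qed
          have "(\<phi> x + y \<bullet> x - e' i x)\<^sup>2 \<le> (\<phi> x - e i x)\<^sup>2 / (1 - l) + (y $ i)\<^sup>2 / l" for i
            using power2_add_le_weighted [of l "\<phi> x - e i x" "y $ i * x $ i"] False l0 \<open>l < 1\<close>
            by (simp add: e' power_mult_distrib sq)
          then have "(\<Sum>i\<in>UNIV. (\<phi> x + y \<bullet> x - e' i x)\<^sup>2)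
              \<le> (\<Sum>i\<in>UNIV. (\<phi> x - e i x)\<^sup>2 / (1 - l) + (y $ i)\<^sup>2 / l)"
            by (rule sum_mono)
          also have "\<dots> = 1 / (1 - l) * D x + (norm y)\<^sup>2 / l"
            by (simp add: sum.distrib D_def sum_divide_distrib norm_y)
          \<comment> \<open>The weight \<open>l\<close> was chosen to match the bound on
            \<open>y\<close>: the perturbation costs exactly the allowed \<open>\<tau>\<close>, and
            \<open>\<phi>\<close> keeps the factor \<open>1 / (1 - l)\<close>.\<close>
          also have "(norm y)\<^sup>2 / l \<le> \<tau>"
            using y l0 False by (simp add: divide_simps mult.commute)
          finally show ?thesis by simp
        qed
      qed simp
      also have "\<dots> = wmean hypercube (\<lambda>x. exp (h \<bullet> x)) (\<lambda>x. 1 / (1 - l) * D x) + \<tau>"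
        unfolding wmean_add by (simp add: wmean_const finite_hypercube hypercube_nonempty)
      finally show "wvar hypercube (\<lambda>x. exp (h \<bullet> x)) (\<lambda>x. \<phi> x + (\<Sum>k<m. t k *\<^sub>R u k) \<bullet> x)
          \<le> wmean hypercube (\<lambda>x. exp (h \<bullet> x)) (\<lambda>x. 1 / (1 - l) * D x) + (\<Sum>k<m. (t k)\<^sup>2)"
        by (simp add: y_def \<tau>_def)
    qed
    moreover have "(\<lambda>x. exp ((\<Sum>k<m. (u k \<bullet> x)\<^sup>2) / 2 + h \<bullet> x)) = w"
      by (simp add: w_def ising_weight_def fun_eq_iff u)
    ultimately have "wvar hypercube w \<phi> \<le> 1 / (1 - l) * wmean hypercube w D"
      by (simp only: wmean_mult)
    then show ?thesis
      using True by (simp add: var dir l_def [symmetric] field_simps)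
  qed
qed

end
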